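(* Let $n \geq 1$ and $d \geq 2$ be integers, and let $\mathbf{x} = (x^1,\ldots,x^d) \in (\mathcal{P}_n)^d$ be chosen uniformly at random (i.e. $x^1,\ldots,x^d$ are independent and each is uniformly distributed on the simplex $\mathcal{P}_n$). Then the expected value of the generalized earth mover's distance is $$\mathbb{E}\big[\mathrm{EMD}(\mathbf{x})\big] = \int_0^1 \sum_{j=1}^n \sum_{k=1}^{d-1} \min\{k,\, d-k\} \binom{d}{k} F_j(z)^k \big(1-F_j(z)\big)^{d-k} \, dz,$$ where, for $1 \leq j \leq n$, $F_j(z)$ is the polynomial $$F_j(z) = \sum_{m=j}^n (-1)^{m-j} \binom{n}{m}\binom{m-1}{j-1} z^m .$$
   Context: $\mathcal{P}_n = \{x = (x_1,\ldots,x_{n+1}) \in \mathbb{R}^{n+1} : \sum_j x_j = 1,\ x_j \geq 0\}$ is the standard $n$-simplex, viewed as the set of probability distributions on $[n+1] = \{1,\ldots,n+1\}$. The uniform distribution on $\mathcal{P}_n$ is the flat Dirichlet distribution $\mathrm{Dir}(1,\ldots,1)$. Cost function: for $y = (y_1,\ldots,y_d) \in \mathbb{R}^d$, $C(y) = \min_{a \in \mathbb{R}} \big(|y_1 - a| + \cdots + |y_d - a|\big)$. Generalized earth mover's distance: for $\mathbf{x} = (x^1,\ldots,x^d) \in (\mathcal{P}_n)^d$, with $x^i_j$ the $j$th component of $x^i$, $\mathrm{EMD}(\mathbf{x})$ is the minimum of $\sum_{y \in [n+1]^d} C(y)\, T(y)$ over all arrays $T : [n+1]^d \to \mathbb{R}$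 such that $T(y) \geq 0$ for all $y \in [n+1]^d$ and $\sum_{y :\, y_i = j} T(y) = x^i_j$ for all $i \in \{1,\ldots,d\}$ and $j \in \{1,\ldots,n+1\}$. *)

theory Defs
  imports "HOL-Probability.Probability"
begin

text \<open>
  A point of \<open>\<real>\<^sup>n\<close> is an extensional function on \<open>{1..n}\<close>, so that the index sets are the
  numerical sets \<open>{1..n}\<close> and the ordering of the indices is available.
\<close>

definition prob_simplex :: "nat \<Rightarrow> (nat \<Rightarrow> real) set" where
  "prob_simplex n =
     {x \<in> {1..n+1} \<rightarrow>\<^sub>E UNIV. (\<forall>j\<in>{1..n+1}. 0 \<le> x j) \<and> (\<Sum>j=1..n+1. x j) = 1}"

text \<open>
  The flat Dirichlet distribution \<open>Dir(1,\<dots>,1)\<close> has constant density with respect to Lebesgue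
  measure in the first \<open>n\<close> coordinates.  It is therefore defined as the image, under the affine
  parametrisation of the hyperplane \<open>x\<^sub>1 + \<dots> + x\<^sub>n\<^sub>+\<^sub>1 = 1\<close> by its first \<open>n\<close> coordinates, of
  normalised Lebesgue measure on the preimage of the simplex.
\<close>

definition simplex_param :: "nat \<Rightarrow> (nat \<Rightarrow> real) \<Rightarrow> nat \<Rightarrow> real" where
  "simplex_param n x = (\<lambda>j\<in>{1..n+1}. if j \<le> n then x j else 1 - (\<Sum>k=1..n. x k))"

definition simplex_params :: "nat \<Rightarrow> (nat \<Rightarrow> real) set" where
  "simplex_params n = {x \<in> {1..n} \<rightarrow>\<^sub>E UNIV. simplex_param n x \<in> prob_simplex n}"

definition uniform_simplex :: "nat \<Rightarrow> (nat \<Rightarrow> real) measure" where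
  "uniform_simplex n =
     distr (uniform_measure (\<Pi>\<^sub>M j\<in>{1..n}. lborel) (simplex_params n))
       (\<Pi>\<^sub>M j\<in>{1..n+1}. borel) (simplex_param n)"

text \<open>
  Minima are rendered by \<open>LEAST\<close>, not by \<open>Inf\<close>: the value is an attained minimum.
\<close>

definition cost :: "nat \<Rightarrow> (nat \<Rightarrow> real) \<Rightarrow> real" where
  "cost d y = (LEAST c. \<exists>a::real. c = (\<Sum>i=1..d. \<bar>y i - a\<bar>))"

definition multi_index :: "nat \<Rightarrow> nat \<Rightarrow> (nat \<Rightarrow> nat) set" where
  "multi_index n d = {1..d} \<rightarrow>\<^sub>E {1..n+1}"

definition transport_plans ::
    "nat \<Rightarrow> nat \<Rightarrow> (nat \<Rightarrow> nat \<Rightarrow> real) \<Rightarrow> ((nat \<Rightarrow> nat) \<Rightarrow> real) set" where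
  "transport_plans n d x =
     {T. (\<forall>y\<in>multi_index n d. 0 \<le> T y) \<and>
         (\<forall>i\<in>{1..d}. \<forall>j\<in>{1..n+1}. (\<Sum>y | y \<in> multi_index n d \<and> y i = j. T y) = x i j)}"

definition EMD :: "nat \<Rightarrow> nat \<Rightarrow> (nat \<Rightarrow> nat \<Rightarrow> real) \<Rightarrow> real" where
  "EMD n d x =
     (LEAST c. \<exists>T\<in>transport_plans n d x.
        c = (\<Sum>y\<in>multi_index n d. cost d (\<lambda>i. real (y i)) * T y))"

definition F :: "nat \<Rightarrow> nat \<Rightarrow> real \<Rightarrow> real" where
  "F n j z =
     (\<Sum>m=j..n. (-1) ^ (m - j) * real (n choose m) * real ((m - 1) choose (j - 1)) * z ^ m)"

text \<open>The normalisation in \<^const>\<open>uniform_simplex\<close> is not degenerate.\<close>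

lemma simplex_params_eq:
  "simplex_params n =
     {x \<in> space (\<Pi>\<^sub>M j\<in>{1..n}. lborel). (\<forall>j\<in>{1..n}. 0 \<le> x j) \<and> (\<Sum>j=1..n. x j) \<le> 1}"
proof -
  have "(\<Sum>j=1..n+1. simplex_param n x j) = 1" for x
  proof -
    have "(\<Sum>j=1..n. simplex_param n x j) = (\<Sum>j=1..n. x j)"
      by (intro sum.cong) (auto simp: simplex_param_def)
    then show ?thesis by (simp add: simplex_param_def)
  qed
  moreover have "(\<forall>j\<in>{1..n+1}. 0 \<le> simplex_param n x j) \<longleftrightarrow>
      (\<forall>j\<in>{1..n}. 0 \<le> x j) \<and> (\<Sum>j=1..n. x j) \<le> 1" for x
  proof -
    have "{1..n+1} = insert (n+1) {1..n}" by auto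
    then show ?thesis by (auto simp: simplex_param_def)
  qed
  moreover have "simplex_param n x \<in> {1..n+1} \<rightarrow>\<^sub>E UNIV" for x
    by (auto simp: simplex_param_def)
  ultimately show ?thesis
    by (auto simp: simplex_params_def prob_simplex_def space_PiM)
qed

lemma simplex_params_sets [measurable]: "simplex_params n \<in> sets (\<Pi>\<^sub>M j\<in>{1..n}. lborel)"
  unfolding simplex_params_eq by measurable

lemma simplex_param_measurable [measurable]:
  "simplex_param n \<in> (\<Pi>\<^sub>M j\<in>{1..n}. lborel) \<rightarrow>\<^sub>M (\<Pi>\<^sub>M j\<in>{1..n+1}. borel)"
  unfolding simplex_param_def
proof (rule measurable_restrict)
  fix j assume j: "j \<in> {1..n+1}"
  have comp: "(\<lambda>x. x k) \<in> borel_measurable (\<Pi>\<^sub>M j\<in>{1..n}. lborel :: real measure)" if "k \<in> {1..n}" for k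
    using measurable_component_singleton[OF that, of "\<lambda>_. lborel :: real measure"] by simp
  show "(\<lambda>x. if j \<le> n then x j else 1 - (\<Sum>k=1..n. x k))
      \<in> borel_measurable (\<Pi>\<^sub>M j\<in>{1..n}. lborel)"
  proof (cases "j \<le> n")
    case True
    with j comp[of j] show ?thesis by simp
  next
    case False
    then show ?thesis by (auto intro!: borel_measurable_diff borel_measurable_sum comp)
  qed
qed

lemma emeasure_simplex_params:
  "emeasure (\<Pi>\<^sub>M j\<in>{1..n}. lborel) (simplex_params n) = ennreal (1 / fact n)"
proof -
  have "simplex_params n = {x. (\<forall>j\<in>{1..n}. 0 \<le> x j) \<and> sum x {1..n} \<le> 1} \<inter>
      space (\<Pi>\<^sub>M j\<in>{1..n}. lborel)"
    by (auto simp: simplex_params_eq)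
  then show ?thesis
    using emeasure_std_simplex_aux[of "{1..n}" 1] by simp
qed

lemma prob_space_uniform_simplex: "prob_space (uniform_simplex n)"
proof -
  interpret prob_space "uniform_measure (\<Pi>\<^sub>M j\<in>{1..n}. lborel) (simplex_params n)"
    by (rule prob_space_uniform_measure) (simp_all only: emeasure_simplex_params, simp_all)
  show ?thesis
    unfolding uniform_simplex_def using simplex_param_measurable
    by (intro prob_space_distr) (simp only: measurable_cong_sets[OF sets_uniform_measure refl])
qed

end

theory Submission
  imports Defs
begin

text \<open>
  For an integer vector \<open>y\<close> the cost splits over the layers \<open>j = 1,\<dots>,n\<close> as the sum of
  \<open>min k (d - k)\<close> with \<open>k = #{i. j < y\<^sub>i}\<close>.  Coupling the marginals through their quantile
  functions and averaging the optimal centres (Jensen) shows that this splitting survives on the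
  level of distributions: with cumulative sums \<open>S\<^sup>i\<^sub>j\<close>, the distance equals the sum over \<open>j\<close> of
  \<open>\<integral> min k (d - k) dt\<close> for \<open>k = #{i. S\<^sup>i\<^sub>j \<le> t}\<close>.  For independent uniform points this count is
  binomial with parameter \<open>P(S\<^sub>j \<le> t)\<close>, and Fubini gives the formula once this probability is
  identified with \<open>F\<^sub>j(t)\<close>.  Both satisfy the same downward recursion in \<open>j\<close>: the event
  \<open>S\<^sub>j \<le> t < S\<^sub>j\<^sub>+\<^sub>1\<close> has probability \<open>(n choose j) t\<^sup>j (1 - t)\<^sup>n\<^sup>-\<^sup>j\<close>.
\<close>

section \<open>The cost function\<close>

text \<open>The cost of a 0/1 vector of length \<open>d\<close> with \<open>k\<close> ones: the
  majority value is an optimal centre, and the minority is paid for.\<close>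

definition balance :: "nat \<Rightarrow> nat \<Rightarrow> real" where
  "balance d k = real (min k (d - k))"

lemma balance_nonneg: "0 \<le> balance d k"
  by (simp add: balance_def)

lemma balance_le: "balance d k \<le> real d"
  by (simp add: balance_def)

lemma sum_abs_of_bool_diff:
  fixes \<theta> :: real
  assumes "finite I"
  shows "(\<Sum>i\<in>I. \<bar>of_bool (P i) - \<theta>\<bar>) =
    real (card {i\<in>I. P i}) * \<bar>1 - \<theta>\<bar> + real (card I - card {i\<in>I. P i}) * \<bar>\<theta>\<bar>"
proof -
  have "card I - card {i\<in>I. P i} = card {i\<in>I. \<not> P i}"
    using assms by (subst card_Diff_subset [symmetric]) (auto intro!: arg_cong[where f = card])
  moreover have "(\<Sum>i\<in>I. \<bar>of_bool (P i) - \<theta>\<bar>) = (\<Sum>i\<in>I. if P i then \<bar>1 - \<theta>\<bar> else \<bar>\<theta>\<bar>)"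
    by (intro sum.cong) auto
  ultimately show ?thesis
    using assms by (simp add: sum.If_cases Int_def)
qed

text \<open>The right-hand side is \<open>k * (1 - \<theta>) + (d - k) * \<theta>\<close>, a convex
  combination of \<open>k\<close> and \<open>d - k\<close>, hence at least their minimum.\<close>

lemma balance_le_sum_abs:
  fixes \<theta> :: real
  assumes "0 \<le> \<theta>" "\<theta> \<le> 1"
  shows "balance d (card {i\<in>{1..d}. P i}) \<le> (\<Sum>i=1..d. \<bar>of_bool (P i) - \<theta>\<bar>)"
proof -
  define k where "k = card {i\<in>{1..d}. P i}"
  have "balance d k = balance d k * (1 - \<theta>) + balance d k * \<theta>"
    by (simp add: algebra_simps)
  also have "\<dots> \<le> real k * (1 - \<theta>) + real (d - k) * \<theta>"
    using assms by (intro add_mono mult_right_mono) (auto simp: balance_def)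
  finally show ?thesis
    using assms by (subst sum_abs_of_bool_diff) (auto simp: k_def)
qed

text \<open>Each clamp is a difference of consecutive positive parts \<open>max 0 (a - j)\<close>,
  so the sum telescopes.\<close>

lemma sum_unit_clamp:
  fixes a :: real
  assumes "p \<le> q"
  shows "(\<Sum>j=p..<q. max 0 (min 1 (a - real j))) = max 0 (a - real p) - max 0 (a - real q)"
proof -
  have "(\<Sum>j=p..<q. max 0 (min 1 (a - real j))) =
      (\<Sum>j=p..<q. - max 0 (a - real (Suc j)) - - max 0 (a - real j))"
    by (intro sum.cong) (auto simp: max_def min_def)
  also have "\<dots> = - max 0 (a - real q) - - max 0 (a - real p)"
    using assms by (intro sum_Suc_diff')
  finally show ?thesis by simp
qed

text \<open>The clamp is the length of the part of \<open>[j, j + 1]\<close> below \<open>a\<close>;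
  it extends \<open>of_bool (j < a)\<close> to real centres. The layers add up to the distance from
  \<open>y\<close> to the projection of \<open>a\<close> onto \<open>[1, n + 1]\<close>, and
  projecting cannot increase the distance to \<open>y\<close>.\<close>

lemma layers_le_abs_diff:
  fixes a :: real
  assumes "y \<in> {1..n+1}"
  shows "(\<Sum>j=1..n. \<bar>of_bool (j < y) - max 0 (min 1 (a - real j))\<bar>) \<le> \<bar>real y - a\<bar>"
proof -
  let ?\<theta> = "\<lambda>j. max 0 (min 1 (a - real j))"
  have "{1..n} = {1..<y} \<union> {y..<n+1}" using assms by auto
  then have "(\<Sum>j=1..n. \<bar>of_bool (j < y) - ?\<theta> j\<bar>) =
      (\<Sum>j=1..<y. \<bar>of_bool (j < y) - ?\<theta> j\<bar>) + (\<Sum>j=y..<n+1. \<bar>of_bool (j < y) - ?\<theta> j\<bar>)"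
    by (simp only:) (rule sum.union_disjoint, auto)
  also have "(\<Sum>j=1..<y. \<bar>of_bool (j < y) - ?\<theta> j\<bar>) = (\<Sum>j=1..<y. 1 - ?\<theta> j)"
    by (intro sum.cong) auto
  also have "(\<Sum>j=y..<n+1. \<bar>of_bool (j < y) - ?\<theta> j\<bar>) = (\<Sum>j=y..<n+1. ?\<theta> j)"
    by (intro sum.cong) auto
  also have "(\<Sum>j=1..<y. 1 - ?\<theta> j) = real y - 1 - (\<Sum>j=1..<y. ?\<theta> j)"
    using assms by (simp add: sum_subtractf of_nat_diff)
  also have "(\<Sum>j=1..<y. ?\<theta> j) = max 0 (a - real 1) - max 0 (a - real y)"
    using assms by (intro sum_unit_clamp) auto
  also have "(\<Sum>j=y..<n+1. ?\<theta> j) = max 0 (a - real y) - max 0 (a - real (n+1))"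
    using assms by (intro sum_unit_clamp) auto
  finally show ?thesis
    using assms by (auto simp: max_def abs_if split: if_splits)
qed

lemma abs_diff_eq_layers:
  assumes "y \<in> {1..n+1}" "a \<in> {1..n+1}"
  shows "\<bar>real y - real a\<bar> = (\<Sum>j=1..n. \<bar>of_bool (j < y) - of_bool (j < a)\<bar>)"
  using assms
proof (induction y a rule: linorder_wlog)
  case (le y a)
  have "(\<Sum>j=1..n. \<bar>of_bool (j < y) - of_bool (j < a)\<bar>) = (\<Sum>j=1..n. if j \<in> {y..<a} then 1 else (0::real))"
    using le by (intro sum.cong) auto
  also have "\<dots> = (\<Sum>j\<in>{1..n} \<inter> {y..<a}. 1)"
    by (simp only: sum.inter_restrict finite_atLeastAtMost)
  also have "{1..n} \<inter> {y..<a} = {y..<a}" using le by auto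
  finally show ?case using le by (simp add: of_nat_diff)
next
  case (sym y a)
  then show ?case by (simp add: abs_minus_commute)
qed

text \<open>A real centre induces one threshold in \<open>[0, 1]\<close> per layer, and each layer
  is then bounded separately.\<close>

lemma cost_lower_bound:
  fixes a :: real
  assumes "\<And>i. i \<in> {1..d} \<Longrightarrow> y i \<in> {1..n+1}"
  shows "(\<Sum>j=1..n. balance d (card {i\<in>{1..d}. j < y i})) \<le> (\<Sum>i=1..d. \<bar>real (y i) - a\<bar>)"
proof -
  have "(\<Sum>j=1..n. balance d (card {i\<in>{1..d}. j < y i})) \<le>
      (\<Sum>j=1..n. \<Sum>i=1..d. \<bar>of_bool (j < y i) - max 0 (min 1 (a - real j))\<bar>)"
    by (intro sum_mono balance_le_sum_abs) auto
  also have "\<dots> = (\<Sum>i=1..d. \<Sum>j=1..n. \<bar>of_bool (j < y i) - max 0 (min 1 (a - real j))\<bar>)"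
    by (rule sum.swap)
  also have "\<dots> \<le> (\<Sum>i=1..d. \<bar>real (y i) - a\<bar>)"
    using assms by (intro sum_mono layers_le_abs_diff)
  finally show ?thesis .
qed

text \<open>The count \<open>k j\<close> is antitone in \<open>j\<close>, so a single integer
  \<open>a\<close> separates the layers where the entries above form a strict majority from the
  others. Its 0/1 threshold is therefore optimal in all layers at once.\<close>

lemma median_exists:
  assumes "\<And>i. i \<in> {1..d} \<Longrightarrow> y i \<in> {1..n+1}"
  shows "\<exists>a\<in>{1..n+1}. (\<Sum>j=1..n. balance d (card {i\<in>{1..d}. j < y i})) =
    (\<Sum>i=1..d. \<bar>real (y i) - real a\<bar>)"
proof -
  define k where "k j = card {i\<in>{1..d}. j < y i}" for j
  \<comment> \<open>A median: the least index exceeded by at most half of the entries. Such an index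
    exists because no entry exceeds \<open>n + 1\<close>.\<close>
  define a where "a = (LEAST a. 1 \<le> a \<and> 2 * k a \<le> d)"
  have empty: "{i\<in>{1..d}. n + 1 < y i} = {}" using assms by force
  have ex: "1 \<le> n + 1 \<and> 2 * k (n+1) \<le> d"
    unfolding k_def empty by simp
  have a: "1 \<le> a" "2 * k a \<le> d"
    using LeastI[of "\<lambda>a. 1 \<le> a \<and> 2 * k a \<le> d", OF ex] by (auto simp: a_def)
  have "a \<le> n + 1"
    using Least_le[of "\<lambda>a. 1 \<le> a \<and> 2 * k a \<le> d", OF ex] by (simp add: a_def)
  with a have a_mem: "a \<in> {1..n+1}" by simp
  have layer: "(\<Sum>i=1..d. \<bar>of_bool (j < y i) - of_bool (j < a)\<bar>) = balance d (k j)"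
    if "1 \<le> j" for j
  proof (cases "j < a")
    case True
    then have "d < 2 * k j"
      using not_less_Least[of j "\<lambda>a. 1 \<le> a \<and> 2 * k a \<le> d"] that by (simp add: a_def)
    moreover have "(\<Sum>i=1..d. \<bar>of_bool (j < y i) - of_bool (j < a)\<bar>) = real (d - k j)"
      using True sum_abs_of_bool_diff[of "{1..d}" "\<lambda>i. j < y i" "of_bool (j < a)"]
      by (simp add: k_def)
    ultimately show ?thesis by (simp add: balance_def)
  next
    case False
    then have "k j \<le> k a" unfolding k_def by (intro card_mono) auto
    then have "2 * k j \<le> d" using a by simp
    moreover have "(\<Sum>i=1..d. \<bar>of_bool (j < y i) - of_bool (j < a)\<bar>) = real (k j)"
      using False sum_abs_of_bool_diff[of "{1..d}" "\<lambda>i. j < y i" "of_bool (j < a)"]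
      by (simp add: k_def)
    ultimately show ?thesis by (simp add: balance_def)
  qed
  have "(\<Sum>i=1..d. \<bar>real (y i) - real a\<bar>) =
      (\<Sum>i=1..d. \<Sum>j=1..n. \<bar>of_bool (j < y i) - of_bool (j < a)\<bar>)"
    using assms a_mem by (intro sum.cong abs_diff_eq_layers) auto
  also have "\<dots> = (\<Sum>j=1..n. \<Sum>i=1..d. \<bar>of_bool (j < y i) - of_bool (j < a)\<bar>)"
    by (rule sum.swap)
  also have "\<dots> = (\<Sum>j=1..n. balance d (k j))"
    by (intro sum.cong layer) auto
  finally show ?thesis
    unfolding k_def by (intro bexI[OF _ a_mem]) (rule sym)
qed

text \<open>The lower bound for all real centres is attained at an integer median, so the
  \<open>LEAST\<close> in \<open>cost\<close> is a true minimum.\<close>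

lemma cost_eq_layers:
  assumes "\<And>i. i \<in> {1..d} \<Longrightarrow> y i \<in> {1..n+1}"
  shows "cost d (\<lambda>i. real (y i)) = (\<Sum>j=1..n. balance d (card {i\<in>{1..d}. j < y i}))"
proof -
  have "\<exists>a\<in>{1..n+1}. (\<Sum>j=1..n. balance d (card {i\<in>{1..d}. j < y i})) =
      (\<Sum>i=1..d. \<bar>real (y i) - real a\<bar>)"
    using assms by (rule median_exists)
  moreover have "(\<Sum>j=1..n. balance d (card {i\<in>{1..d}. j < y i})) \<le>
      (\<Sum>i=1..d. \<bar>real (y i) - b\<bar>)" for b
    using assms by (rule cost_lower_bound)
  ultimately show ?thesis
    unfolding cost_def by (intro Least_equality) blast+
qed

section \<open>The earth mover's distance in terms of cumulative sums\<close>

definition partial_sum :: "(nat \<Rightarrow> real) \<Rightarrow> nat \<Rightarrow> real" where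
  "partial_sum x j = (\<Sum>k=1..j. x k)"

text \<open>The continuous analogue of the layer sum in \<open>cost_eq_layers\<close>, with real
  thresholds \<open>t\<close> in place of integer layers. Counting \<open>s i \<le> t\<close> rather
  than \<open>t < s i\<close> is harmless, since \<open>balance\<close> is symmetric under
  exchanging \<open>k\<close> and \<open>d - k\<close>.\<close>

definition balance_integral :: "nat \<Rightarrow> (nat \<Rightarrow> real) \<Rightarrow> real" where
  "balance_integral d s = (LINT t|lborel. balance d (card {i\<in>{1..d}. s i \<le> t}))"

lemma has_integral_step_diff:
  fixes a b :: real
  shows "has_bochner_integral lborel (\<lambda>t. \<bar>of_bool (a \<le> t) - of_bool (b \<le> t)\<bar>) \<bar>a - b\<bar>"
proof -
  have "has_bochner_integral lborel (indicator {min a b..<max a b}) (measure lborel {min a b..<max a b})"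
    by (intro has_bochner_integral_real_indicator) (auto simp: min_def max_def)
  also have "measure lborel {min a b..<max a b} = \<bar>a - b\<bar>"
    by (auto simp: min_def max_def)
  also have "indicator {min a b..<max a b} = (\<lambda>t. \<bar>of_bool (a \<le> t) - of_bool (b \<le> t)\<bar> :: real)"
    by (auto simp: fun_eq_iff indicator_def min_def max_def)
  finally show ?thesis .
qed

lemma integrable_step_diff: "integrable lborel (\<lambda>t. \<bar>of_bool (a \<le> t) - of_bool (b \<le> t)\<bar> :: real)"
  and integral_step_diff: "(LINT t|lborel. \<bar>of_bool (a \<le> t) - of_bool (b \<le> t)\<bar>) = \<bar>a - b\<bar>"
  for a b :: real
  using has_integral_step_diff[of a b] by (simp_all add: has_bochner_integral_iff)

lemma borel_measurable_card_comp:
  fixes f :: "nat \<Rightarrow> real" and I :: "nat set"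
  assumes "\<And>i. i \<in> I \<Longrightarrow> {\<omega>\<in>space M. P i \<omega>} \<in> sets M"
  shows "(\<lambda>\<omega>. f (card {i\<in>I. P i \<omega>})) \<in> borel_measurable M"
proof -
  have "{\<omega>\<in>space M. i \<in> {i\<in>I. P i \<omega>}} \<in> sets M" for i
    using assms by (cases "i \<in> I") auto
  then show ?thesis
    by (intro measurable_compose[OF measurable_card, where g = f]) auto
qed

lemma integrable_balance_level:
  fixes s :: "nat \<Rightarrow> real"
  shows "integrable lborel (\<lambda>t. balance d (card {i\<in>{1..d}. s i \<le> t}))"
proof (rule Bochner_Integration.integrable_bound)
  \<comment> \<open>The centre 0 is an arbitrary choice: comparing with a fixed step function makes
    each summand vanish outside a bounded interval.\<close>
  show "integrable lborel (\<lambda>t. \<Sum>i=1..d. \<bar>of_bool (s i \<le> t) - of_bool (0 \<le> t)\<bar> :: real)"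
    by (intro Bochner_Integration.integrable_sum integrable_step_diff)
  show "(\<lambda>t. balance d (card {i\<in>{1..d}. s i \<le> t})) \<in> borel_measurable lborel"
    by (rule borel_measurable_card_comp) auto
  show "AE t in lborel. norm (balance d (card {i\<in>{1..d}. s i \<le> t})) \<le>
      norm (\<Sum>i=1..d. \<bar>of_bool (s i \<le> t) - of_bool (0 \<le> t)\<bar> :: real)"
    using balance_le_sum_abs
    by (intro AE_I2) (auto simp: balance_nonneg sum_nonneg)
qed

text \<open>At each level the threshold \<open>of_bool (\<tau> \<le> t)\<close> is admissible in
  \<open>balance_le_sum_abs\<close>; integration over \<open>t\<close> turns differences of steps
  into distances.\<close>

lemma balance_integral_le:
  "balance_integral d s \<le> (\<Sum>i=1..d. \<bar>s i - \<tau>\<bar>)"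
proof -
  have "balance_integral d s \<le> (LINT t|lborel. (\<Sum>i=1..d. \<bar>of_bool (s i \<le> t) - of_bool (\<tau> \<le> t)\<bar>))"
    unfolding balance_integral_def
    by (intro integral_mono integrable_balance_level Bochner_Integration.integrable_sum
      integrable_step_diff balance_le_sum_abs) auto
  also have "\<dots> = (\<Sum>i=1..d. \<bar>s i - \<tau>\<bar>)"
    by (subst Bochner_Integration.integral_sum) (simp_all only: integrable_step_diff integral_step_diff)
  finally show ?thesis .
qed

section \<open>Transport plans and the lower bound for their cost\<close>

lemma finite_multi_index [simp]: "finite (multi_index n d)"
  by (simp add: multi_index_def finite_PiE)

lemma multi_indexD: "y \<in> multi_index n d \<Longrightarrow> i \<in> {1..d} \<Longrightarrow> y i \<in> {1..n+1}"
  unfolding multi_index_def by auto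

text \<open>Grouping by the value of \<open>y i\<close> turns the marginal conditions into
  conditions on cumulative sums, the form that matches the layers.\<close>

lemma transport_plan_le_sum:
  assumes "T \<in> transport_plans n d x" "i \<in> {1..d}" "j \<le> n + 1"
  shows "(\<Sum>y\<in>multi_index n d. T y * of_bool (y i \<le> j)) = partial_sum (x i) j"
proof -
  let ?Y = "multi_index n d"
  have "(\<Sum>y\<in>?Y. T y * of_bool (y i \<le> j)) = (\<Sum>y\<in>{y\<in>?Y. y i \<le> j}. T y)"
    by (simp only: sum.inter_filter finite_multi_index) (intro sum.cong, auto)
  also have "\<dots> = (\<Sum>k=1..j. \<Sum>y\<in>{y\<in>{y\<in>?Y. y i \<le> j}. y i = k}. T y)"
    using multi_indexD[OF _ assms(2)] by (intro sum.group [symmetric]) fastforce+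
  also have "\<dots> = (\<Sum>k=1..j. \<Sum>y | y \<in> ?Y \<and> y i = k. T y)"
    by (intro sum.cong refl) auto
  also have "\<dots> = (\<Sum>k=1..j. x i k)"
    using assms by (intro sum.cong refl) (auto simp: transport_plans_def)
  finally show ?thesis by (simp add: partial_sum_def)
qed

text \<open>
  Jensen's inequality: the optimal centres \<open>a y\<close> of the individual multi-indices average to a
  centre \<open>\<tau> j\<close> for the cumulative sums.
\<close>

lemma balance_integral_le_plan_cost:
  assumes T: "T \<in> transport_plans n d x"
  shows "(\<Sum>j=1..n. balance_integral d (\<lambda>i. partial_sum (x i) j)) \<le>
    (\<Sum>y\<in>multi_index n d. cost d (\<lambda>i. real (y i)) * T y)"
proof -
  let ?Y = "multi_index n d"
  have T_nonneg: "0 \<le> T y" if "y \<in> ?Y" for y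
    using T that by (auto simp: transport_plans_def)
  have "\<forall>y\<in>?Y. \<exists>a\<in>{1..n+1}. cost d (\<lambda>i. real (y i)) = (\<Sum>i=1..d. \<bar>real (y i) - real a\<bar>)"
  proof
    fix y assume y: "y \<in> ?Y"
    have "cost d (\<lambda>i. real (y i)) = (\<Sum>j=1..n. balance d (card {i\<in>{1..d}. j < y i}))"
      using multi_indexD[OF y] by (rule cost_eq_layers)
    then show "\<exists>a\<in>{1..n+1}. cost d (\<lambda>i. real (y i)) = (\<Sum>i=1..d. \<bar>real (y i) - real a\<bar>)"
      using median_exists[of d y n] multi_indexD[OF y] by simp
  qed
  then obtain a where a: "\<And>y. y \<in> ?Y \<Longrightarrow> a y \<in> {1..n+1}"
      "\<And>y. y \<in> ?Y \<Longrightarrow> cost d (\<lambda>i. real (y i)) = (\<Sum>i=1..d. \<bar>real (y i) - real (a y)\<bar>)"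
    unfolding bchoice_iff Bex_def by blast
  \<comment> \<open>The cumulative distribution of the chosen medians under the plan
    \<open>T\<close>.\<close>
  define \<tau> where "\<tau> j = (\<Sum>y\<in>?Y. T y * of_bool (a y \<le> j))" for j
  have "(\<Sum>j=1..n. balance_integral d (\<lambda>i. partial_sum (x i) j)) \<le>
      (\<Sum>j=1..n. \<Sum>i=1..d. \<bar>partial_sum (x i) j - \<tau> j\<bar>)"
    by (intro sum_mono balance_integral_le)
  also have "\<dots> \<le> (\<Sum>j=1..n. \<Sum>i=1..d. \<Sum>y\<in>?Y. T y * \<bar>of_bool (j < y i) - of_bool (j < a y)\<bar>)"
  proof (intro sum_mono)
    fix j i assume ij: "j \<in> {1..n}" "i \<in> {1..d}"
    have "partial_sum (x i) j - \<tau> j = (\<Sum>y\<in>?Y. T y * (of_bool (y i \<le> j) - of_bool (a y \<le> j)))"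
      using transport_plan_le_sum[OF T ij(2), of j] ij
      by (simp add: \<tau>_def sum_subtractf right_diff_distrib)
    also have "\<bar>\<dots>\<bar> \<le> (\<Sum>y\<in>?Y. \<bar>T y * (of_bool (y i \<le> j) - of_bool (a y \<le> j))\<bar>)"
      by (rule sum_abs)
    also have "\<dots> = (\<Sum>y\<in>?Y. T y * \<bar>of_bool (j < y i) - of_bool (j < a y)\<bar>)"
      using T_nonneg by (intro sum.cong) (auto simp: abs_mult not_less)
    finally show "\<bar>partial_sum (x i) j - \<tau> j\<bar> \<le>
        (\<Sum>y\<in>?Y. T y * \<bar>of_bool (j < y i) - of_bool (j < a y)\<bar>)" .
  qed
  also have "\<dots> = (\<Sum>y\<in>?Y. \<Sum>j=1..n. \<Sum>i=1..d. T y * \<bar>of_bool (j < y i) - of_bool (j < a y)\<bar>)"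
    by (subst sum.swap, subst (2) sum.swap, subst sum.swap, subst (2) sum.swap, rule refl)
  also have "\<dots> = (\<Sum>y\<in>?Y. cost d (\<lambda>i. real (y i)) * T y)"
  proof (intro sum.cong refl)
    fix y assume y: "y \<in> ?Y"
    \<comment> \<open>Here the layer decomposition is an equality, because the chosen centre
      \<open>a y\<close> is an integer in range.\<close>
    have "cost d (\<lambda>i. real (y i)) = (\<Sum>i=1..d. \<Sum>j=1..n. \<bar>of_bool (j < y i) - of_bool (j < a y)\<bar>)"
      unfolding a(2)[OF y] using a(1)[OF y] multi_indexD[OF y]
      by (intro sum.cong abs_diff_eq_layers) auto
    then show "(\<Sum>j=1..n. \<Sum>i=1..d. T y * \<bar>of_bool (j < y i) - of_bool (j < a y)\<bar>) =
        cost d (\<lambda>i. real (y i)) * T y"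
      by (subst sum.swap) (simp add: sum_distrib_left mult.commute)
  qed
  finally show ?thesis .
qed

text \<open>
  Total masses are not normalised, so that \<open>EMD\<close> is known for every argument, also outside the
  simplices: measurability of the distance is needed on the whole sample space.
\<close>

definition feasible :: "nat \<Rightarrow> nat \<Rightarrow> (nat \<Rightarrow> nat \<Rightarrow> real) \<Rightarrow> bool" where
  "feasible n d x \<longleftrightarrow> (\<forall>i\<in>{1..d}. (\<forall>j\<in>{1..n+1}. 0 \<le> x i j) \<and>
     partial_sum (x i) (n + 1) = partial_sum (x 1) (n + 1))"

text \<open>All marginals of a plan share its total mass and inherit its nonnegativity.\<close>

lemma feasible_if_transport_plan:
  assumes T: "T \<in> transport_plans n d x" and "1 \<le> d"
  shows "feasible n d x"
proof -
  let ?Y = "multi_index n d"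
  have "0 \<le> x i j" if "i \<in> {1..d}" "j \<in> {1..n+1}" for i j
  proof -
    have "x i j = (\<Sum>y | y \<in> ?Y \<and> y i = j. T y)"
      using T that unfolding transport_plans_def by auto
    also have "\<dots> \<ge> 0"
      using T by (intro sum_nonneg) (auto simp: transport_plans_def)
    finally show ?thesis .
  qed
  moreover have "partial_sum (x i) (n + 1) = (\<Sum>y\<in>?Y. T y)" if "i \<in> {1..d}" for i
  proof -
    have "partial_sum (x i) (n + 1) = (\<Sum>y\<in>?Y. T y * of_bool (y i \<le> n + 1))"
      using transport_plan_le_sum[OF T that] by simp
    also have "\<dots> = (\<Sum>y\<in>?Y. T y)"
      using multi_indexD[OF _ that] by (intro sum.cong) auto
    finally show ?thesis .
  qed
  ultimately show ?thesis using \<open>1 \<le> d\<close> by (auto simp: feasible_def)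
qed

text \<open>
  The optimal plan couples the marginals through their quantile functions: \<open>quantile_cell y\<close>
  consists of the levels \<open>t\<close> at which the \<open>i\<close>-th quantile function takes the value \<open>y i\<close>.
\<close>

definition quantile_cell :: "nat \<Rightarrow> (nat \<Rightarrow> nat \<Rightarrow> real) \<Rightarrow> (nat \<Rightarrow> nat) \<Rightarrow> real set" where
  "quantile_cell d x y =
     (\<Inter>i\<in>{1..d}. {partial_sum (x i) (y i - 1)..<partial_sum (x i) (y i)})"

lemma partial_sum_0 [simp]: "partial_sum x 0 = 0"
  by (simp add: partial_sum_def)

lemma partial_sum_diff: "1 \<le> j \<Longrightarrow> partial_sum x j - partial_sum x (j - 1) = x j"
  by (cases j) (auto simp: partial_sum_def)

lemma partial_sum_mono:
  assumes "\<And>j. j \<in> {1..n} \<Longrightarrow> 0 \<le> x j" "j \<le> k" "k \<le> n"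
  shows "partial_sum x j \<le> partial_sum x k"
  unfolding partial_sum_def using assms by (intro sum_mono2) auto

section \<open>Optimality of the quantile coupling\<close>

context
  fixes n d :: nat and x :: "nat \<Rightarrow> nat \<Rightarrow> real"
  assumes feasible: "feasible n d x" and d: "1 \<le> d"
begin

text \<open>Restricted to \<open>{1..d}\<close> so that the value can be an element of
  \<open>multi_index\<close>. It is meaningful only for levels from 0 up to the total mass: below 0
  the \<open>LEAST\<close> is 0, which is no index, and above it depends on entries beyond
  \<open>n + 1\<close>.\<close>

private definition quantile :: "real \<Rightarrow> nat \<Rightarrow> nat" where
  "quantile t = (\<lambda>i\<in>{1..d}. LEAST j. t < partial_sum (x i) j)"

private lemma mono_sums: "i \<in> {1..d} \<Longrightarrow> j \<le> k \<Longrightarrow> k \<le> n + 1 \<Longrightarrow> partial_sum (x i) j \<le> partial_sum (x i) k"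
  using feasible by (intro partial_sum_mono[of "n+1"]) (auto simp: feasible_def)

private lemma total: "i \<in> {1..d} \<Longrightarrow> partial_sum (x i) (n + 1) = partial_sum (x 1) (n + 1)"
  using feasible unfolding feasible_def by blast

text \<open>By monotonicity of the cumulative sums, comparing \<open>y i\<close> with an index
  amounts to comparing \<open>t\<close> with a cumulative sum. This converts layer counts of
  \<open>y\<close> into level counts at \<open>t\<close>.\<close>

private lemma mem_quantile_cell:
  assumes y: "y \<in> multi_index n d" and t: "t \<in> quantile_cell d x y" and i: "i \<in> {1..d}" and j: "j \<le> n + 1"
  shows "j < y i \<longleftrightarrow> partial_sum (x i) j \<le> t"
proof
  have *: "partial_sum (x i) (y i - 1) \<le> t" "t < partial_sum (x i) (y i)"
    using t i by (auto simp: quantile_cell_def)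
  have yi: "y i \<in> {1..n+1}" by (rule multi_indexD[OF y i])
  show "partial_sum (x i) j \<le> t" if "j < y i"
  proof -
    have "j \<le> y i - 1" "y i - 1 \<le> n + 1" using that yi by auto
    with * show ?thesis using mono_sums[OF i] by (meson order_trans)
  qed
  show "j < y i" if "partial_sum (x i) j \<le> t"
    using mono_sums[OF i, of "y i" j] that j *(2) by (cases "j < y i") auto
qed

private lemma quantile_cell_eq_quantile:
  assumes y: "y \<in> multi_index n d" and t: "t \<in> quantile_cell d x y"
  shows "y = quantile t"
proof
  fix i
  show "y i = quantile t i"
  proof (cases "i \<in> {1..d}")
    case True
    have "(LEAST j. t < partial_sum (x i) j) = y i"
    proof (rule Least_equality)
      show "t < partial_sum (x i) (y i)"
        using t True by (auto simp: quantile_cell_def)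
      show "y i \<le> j" if "t < partial_sum (x i) j" for j
        \<comment> \<open>Indices beyond \<open>n + 1\<close> are treated apart: the entries there
          are unconstrained, but such indices exceed \<open>y i\<close> anyway.\<close>
        using mem_quantile_cell[OF y t True, of j] multi_indexD[OF y True] that
        by (cases "j \<le> n + 1") auto
    qed
    with True show ?thesis by (simp add: quantile_def)
  next
    case False
    with y show ?thesis by (auto simp: quantile_def multi_index_def PiE_def extensional_def)
  qed
qed

private lemma quantile_mem:
  assumes t: "0 \<le> t" "t < partial_sum (x 1) (n + 1)"
  shows "quantile t \<in> multi_index n d" "t \<in> quantile_cell d x (quantile t)"
proof -
  have *: "quantile t i \<in> {1..n+1} \<and> partial_sum (x i) (quantile t i - 1) \<le> t \<and>
      t < partial_sum (x i) (quantile t i)" if i: "i \<in> {1..d}" for i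
  proof -
    define l where "l = (LEAST j. t < partial_sum (x i) j)"
    have ex: "t < partial_sum (x i) (n + 1)" using total[OF i] t by simp
    have l: "t < partial_sum (x i) l" unfolding l_def using ex by (rule LeastI)
    moreover have "l \<le> n + 1" unfolding l_def using ex by (rule Least_le)
    \<comment> \<open>The empty sum is 0 and hence not above \<open>t\<close>; only for
      \<open>l \<noteq> 0\<close> is \<open>l - 1\<close> a smaller index that minimality can
      exclude.\<close>
    moreover have "l \<noteq> 0" using l t by (auto intro: ccontr)
    moreover from this have "\<not> t < partial_sum (x i) (l - 1)"
      unfolding l_def by (intro not_less_Least) auto
    ultimately show ?thesis using i by (auto simp: quantile_def l_def)
  qed
  then show "quantile t \<in> multi_index n d"
    by (auto simp: multi_index_def quantile_def)
  from * show "t \<in> quantile_cell d x (quantile t)"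
    by (auto simp: quantile_cell_def)
qed

text \<open>The first coordinate supplies both bounds, through the comparison at the indices 0 and
  \<open>n + 1\<close>. It exists because \<open>1 \<le> d\<close>; an empty intersection would be
  the whole line.\<close>

private lemma quantile_cell_subset:
  assumes y: "y \<in> multi_index n d"
  shows "quantile_cell d x y \<subseteq> {0..<partial_sum (x 1) (n + 1)}"
proof -
  have 1: "1 \<in> {1..d}" using d by simp
  then have "0 < y 1" "\<not> n + 1 < y 1" using multi_indexD[OF y 1] by auto
  then have "0 \<le> t \<and> t < partial_sum (x 1) (n + 1)" if "t \<in> quantile_cell d x y" for t
    using mem_quantile_cell[OF y that 1, of 0] mem_quantile_cell[OF y that 1, of "n + 1"]
    by (simp add: not_le)
  then show ?thesis by auto
qed

text \<open>The cells thus partition the interval from 0 to the total mass.\<close>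

private lemma mem_quantile_cell_iff:
  assumes y: "y \<in> multi_index n d"
  shows "t \<in> quantile_cell d x y \<longleftrightarrow>
    y = quantile t \<and> 0 \<le> t \<and> t < partial_sum (x 1) (n + 1)"
  using quantile_cell_eq_quantile[OF y, of t] quantile_cell_subset[OF y] quantile_mem(2)[of t]
  by (metis atLeastLessThan_iff subsetD)

private lemma sets_quantile_cell [measurable]: "quantile_cell d x y \<in> sets borel"
  unfolding quantile_cell_def using d by (intro sets.finite_INT) auto

private lemma has_integral_quantile_cell:
  assumes "y \<in> multi_index n d"
  shows "has_bochner_integral lborel (indicator (quantile_cell d x y) :: real \<Rightarrow> real)
    (measure lborel (quantile_cell d x y))"
proof (rule has_bochner_integral_real_indicator)
  have "emeasure lborel (quantile_cell d x y) \<le> emeasure lborel {0..<partial_sum (x 1) (n + 1)}"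
    using quantile_cell_subset[OF assms] by (intro emeasure_mono) auto
  also have "\<dots> < \<infinity>"
    using mono_sums[of 1 0 "n + 1"] d by simp
  finally show "emeasure lborel (quantile_cell d x y) < \<infinity>" .
qed simp

text \<open>By disjointness of the cells, at most one term survives at each level.\<close>

private lemma sum_quantile_cell:
  assumes "A \<subseteq> multi_index n d"
  shows "(\<Sum>y\<in>A. f y * indicator (quantile_cell d x y) t) =
    (if 0 \<le> t \<and> t < partial_sum (x 1) (n + 1) \<and> quantile t \<in> A then f (quantile t) else (0::real))"
proof -
  have fin: "finite A" using assms by (rule finite_subset) simp
  have "indicator (quantile_cell d x y) t =
      (if y = quantile t then if 0 \<le> t \<and> t < partial_sum (x 1) (n + 1) then 1 else 0 else (0::real))"
    if "y \<in> A" for y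
    using mem_quantile_cell_iff[of y t] that assms by (simp add: indicator_def subset_iff)
  then have "(\<Sum>y\<in>A. f y * indicator (quantile_cell d x y) t) =
      (\<Sum>y\<in>A. if y = quantile t then f y * (if 0 \<le> t \<and> t < partial_sum (x 1) (n + 1) then 1 else 0) else 0)"
    by (intro sum.cong) auto
  also have "\<dots> = (if 0 \<le> t \<and> t < partial_sum (x 1) (n + 1) \<and> quantile t \<in> A then f (quantile t) else 0)"
    using fin by (simp add: sum.delta')
  finally show ?thesis .
qed

text \<open>The cells with \<open>y i = j\<close> partition the interval between the cumulative sums
  at \<open>j - 1\<close> and \<open>j\<close>, whose length is \<open>x i j\<close>. Integrating
  the indicators compares the measures.\<close>

lemma quantile_coupling_is_plan:
  "(\<lambda>y. measure lborel (quantile_cell d x y)) \<in> transport_plans n d x"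
  unfolding transport_plans_def mem_Collect_eq
proof (intro conjI ballI)
  fix i j assume i: "i \<in> {1..d}" and j: "j \<in> {1..n+1}"
  let ?A = "{y \<in> multi_index n d. y i = j}"
  have "has_bochner_integral lborel (\<lambda>t. \<Sum>y\<in>?A. indicator (quantile_cell d x y) t :: real)
      (\<Sum>y\<in>?A. measure lborel (quantile_cell d x y))"
    by (intro has_bochner_integral_sum has_integral_quantile_cell) auto
  moreover have "(\<Sum>y\<in>?A. indicator (quantile_cell d x y) t) =
      (indicator {partial_sum (x i) (j - 1)..<partial_sum (x i) j} t :: real)" for t
  proof -
    have bounds: "0 \<le> partial_sum (x i) (j - 1)" "partial_sum (x i) j \<le> partial_sum (x 1) (n + 1)"
      using mono_sums[OF i, of 0 "j - 1"] mono_sums[OF i, of j "n + 1"] total[OF i] j by auto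
    have "quantile t i = j \<longleftrightarrow> partial_sum (x i) (j - 1) \<le> t \<and> t < partial_sum (x i) j"
      if t: "0 \<le> t" "t < partial_sum (x 1) (n + 1)"
    proof -
      have "quantile t i = j \<longleftrightarrow> j - 1 < quantile t i \<and> \<not> j < quantile t i"
        using j by auto
      moreover have "j \<le> n + 1" "j - 1 \<le> n + 1" using j by auto
      ultimately show ?thesis
        using mem_quantile_cell[OF quantile_mem[OF t] i] by (metis not_less)
    qed
    then show ?thesis
      using sum_quantile_cell[of ?A "\<lambda>_. 1" t] quantile_mem(1)[of t] bounds
      by (auto simp: indicator_def split: if_splits)
  qed
  ultimately have "has_bochner_integral lborel
      (indicator {partial_sum (x i) (j - 1)..<partial_sum (x i) j} :: real \<Rightarrow> real)
      (\<Sum>y\<in>?A. measure lborel (quantile_cell d x y))"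
    by simp
  moreover have "has_bochner_integral lborel
      (indicator {partial_sum (x i) (j - 1)..<partial_sum (x i) j} :: real \<Rightarrow> real)
      (measure lborel {partial_sum (x i) (j - 1)..<partial_sum (x i) j})"
    using mono_sums[OF i, of "j - 1" j] j
    by (intro has_bochner_integral_real_indicator) auto
  ultimately have "(\<Sum>y\<in>?A. measure lborel (quantile_cell d x y)) =
      measure lborel {partial_sum (x i) (j - 1)..<partial_sum (x i) j}"
    by (rule has_bochner_integral_eq)
  also have "\<dots> = x i j"
    using mono_sums[OF i, of "j - 1" j] j partial_sum_diff[of j "x i"] by simp
  finally show "(\<Sum>y | y \<in> multi_index n d \<and> y i = j. measure lborel (quantile_cell d x y)) = x i j" .
qed simp

text \<open>In each layer the integrands agree at levels covered by a cell; elsewhere the left one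
  is 0 and the right one nonnegative.\<close>

lemma quantile_coupling_cost_le:
  "(\<Sum>y\<in>multi_index n d. cost d (\<lambda>i. real (y i)) * measure lborel (quantile_cell d x y)) \<le>
    (\<Sum>j=1..n. balance_integral d (\<lambda>i. partial_sum (x i) j))"
proof -
  let ?Y = "multi_index n d"
  define k where "k j y = card {i\<in>{1..d}. j < y i}" for j and y :: "nat \<Rightarrow> nat"
  have "(\<Sum>y\<in>?Y. cost d (\<lambda>i. real (y i)) * measure lborel (quantile_cell d x y)) =
      (\<Sum>y\<in>?Y. \<Sum>j=1..n. balance d (k j y) * measure lborel (quantile_cell d x y))"
    by (intro sum.cong refl, subst cost_eq_layers, rule multi_indexD) (auto simp: k_def sum_distrib_right)
  also have "\<dots> = (\<Sum>j=1..n. \<Sum>y\<in>?Y. balance d (k j y) * measure lborel (quantile_cell d x y))"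
    by (rule sum.swap)
  also have "\<dots> \<le> (\<Sum>j=1..n. balance_integral d (\<lambda>i. partial_sum (x i) j))"
  proof (rule sum_mono)
    fix j assume j: "j \<in> {1..n}"
    have int: "has_bochner_integral lborel
        (\<lambda>t. \<Sum>y\<in>?Y. balance d (k j y) * indicator (quantile_cell d x y) t)
        (\<Sum>y\<in>?Y. balance d (k j y) * measure lborel (quantile_cell d x y))"
      by (intro has_bochner_integral_sum has_bochner_integral_mult_right has_integral_quantile_cell)
    have "(\<Sum>y\<in>?Y. balance d (k j y) * indicator (quantile_cell d x y) t)
        \<le> balance d (card {i\<in>{1..d}. partial_sum (x i) j \<le> t})" for t
    proof (cases "0 \<le> t \<and> t < partial_sum (x 1) (n + 1)")
      case True
      then have t: "0 \<le> t" "t < partial_sum (x 1) (n + 1)" by auto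
      have "{i\<in>{1..d}. j < quantile t i} = {i\<in>{1..d}. partial_sum (x i) j \<le> t}"
        using mem_quantile_cell[OF quantile_mem[OF t], of _ j] j by auto
      then have "k j (quantile t) = card {i\<in>{1..d}. partial_sum (x i) j \<le> t}"
        by (simp only: k_def)
      with True show ?thesis
        using sum_quantile_cell[of ?Y "\<lambda>y. balance d (k j y)" t] quantile_mem(1)[OF t] by auto
    next
      case False
      then have "(\<Sum>y\<in>?Y. balance d (k j y) * indicator (quantile_cell d x y) t) = 0"
        using sum_quantile_cell[of ?Y "\<lambda>y. balance d (k j y)" t] by auto
      then show ?thesis by (simp only: balance_nonneg)
    qed
    then have "(LINT t|lborel. (\<Sum>y\<in>?Y. balance d (k j y) * indicator (quantile_cell d x y) t)) \<le>
        balance_integral d (\<lambda>i. partial_sum (x i) j)"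
      unfolding balance_integral_def
      by (intro integral_mono integrable_balance_level integrable.intros[OF int])
    then show "(\<Sum>y\<in>?Y. balance d (k j y) * measure lborel (quantile_cell d x y)) \<le>
        balance_integral d (\<lambda>i. partial_sum (x i) j)"
      by (simp only: has_bochner_integral_integral_eq[OF int])
  qed
  finally show ?thesis .
qed

text \<open>The lower bound for every plan meets the upper bound for the quantile coupling, so the
  minimum is attained.\<close>

lemma EMD_eq_balance_integral:
  "EMD n d x = (\<Sum>j=1..n. balance_integral d (\<lambda>i. partial_sum (x i) j))"
  unfolding EMD_def
proof (rule Least_equality)
  show "\<exists>T\<in>transport_plans n d x. (\<Sum>j=1..n. balance_integral d (\<lambda>i. partial_sum (x i) j)) =
      (\<Sum>y\<in>multi_index n d. cost d (\<lambda>i. real (y i)) * T y)"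
    using quantile_coupling_is_plan quantile_coupling_cost_le balance_integral_le_plan_cost
    by (intro bexI[of _ "\<lambda>y. measure lborel (quantile_cell d x y)"] antisym) blast+
next
  fix c
  assume "\<exists>T\<in>transport_plans n d x. c = (\<Sum>y\<in>multi_index n d. cost d (\<lambda>i. real (y i)) * T y)"
  then show "(\<Sum>j=1..n. balance_integral d (\<lambda>i. partial_sum (x i) j)) \<le> c"
    using balance_integral_le_plan_cost by blast
qed

end

text \<open>Without any plan the \<open>LEAST\<close> ranges over nothing and yields an unspecified
  value. It is the same for all such \<open>x\<close>, which is what measurability requires.\<close>

lemma EMD_not_feasible:
  assumes "\<not> feasible n d x" "1 \<le> d"
  shows "EMD n d x = (LEAST c. False)"
proof -
  have "transport_plans n d x = {}"
    using feasible_if_transport_plan assms by blast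
  then show ?thesis unfolding EMD_def by simp
qed

section \<open>Cumulative sums of a uniform point\<close>

lemma F_self: "1 \<le> n \<Longrightarrow> F n n z = z ^ n"
  by (simp add: F_def)

text \<open>Pascal's rule merges the coefficients into \<open>m choose j\<close>; the factor
  \<open>n choose j\<close> splits off, and the binomial theorem sums the rest to a power of
  \<open>1 - z\<close>.\<close>

lemma F_step:
  assumes "1 \<le> j" "j \<le> n"
  shows "F n j z = F n (j + 1) z + real (n choose j) * z ^ j * (1 - z) ^ (n - j)"
proof -
  \<comment> \<open>The range may start at \<open>j\<close>, since the added term contains
    \<open>(j - 1) choose j = 0\<close>; shifting the exponent of -1 causes the sign.\<close>
  have "F n (j + 1) z = (\<Sum>m=j..n. - ((-1) ^ (m - j) * real (n choose m) * real ((m - 1) choose j) * z ^ m))"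
  proof -
    have "{j..n} = insert j {j+1..n}" using assms by auto
    moreover have "(-1) ^ (m - (j + 1)) = - ((-1) ^ (m - j) :: real)" if "j < m" for m
      using that by (simp add: Suc_diff_Suc [symmetric])
    ultimately show ?thesis using assms by (simp add: F_def)
  qed
  then have "F n j z - F n (j + 1) z =
      (\<Sum>m=j..n. (-1) ^ (m - j) * real (n choose m) * real (((m - 1) choose (j - 1)) + ((m - 1) choose j)) * z ^ m)"
    by (simp add: F_def sum.distrib [symmetric] algebra_simps)
  also have "\<dots> = (\<Sum>m=j..n. real (n choose j) * z ^ j * (real ((n - j) choose (m - j)) * (- z) ^ (m - j)))"
  proof (intro sum.cong refl)
    fix m assume m: "m \<in> {j..n}"
    have "((m - 1) choose (j - 1)) + ((m - 1) choose j) = m choose j"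
      using m assms by (cases m; cases j) auto
    moreover have "real (n choose m) * real (m choose j) = real (n choose j) * real ((n - j) choose (m - j))"
      using choose_mult[of j m n] m by (simp flip: of_nat_mult)
    moreover have "z ^ m = z ^ j * z ^ (m - j)" using m by (simp flip: power_add)
    moreover have "(- z) ^ (m - j) = (-1) ^ (m - j) * z ^ (m - j)" by (rule power_minus)
    ultimately show "(-1) ^ (m - j) * real (n choose m) * real (((m - 1) choose (j - 1)) + ((m - 1) choose j)) * z ^ m =
        real (n choose j) * z ^ j * (real ((n - j) choose (m - j)) * (- z) ^ (m - j))"
      by (simp add: mult_ac)
  qed
  also have "\<dots> = real (n choose j) * z ^ j * (\<Sum>m=j..n. real ((n - j) choose (m - j)) * (- z) ^ (m - j))"
    by (simp add: sum_distrib_left)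
  also have "(\<Sum>m=j..n. real ((n - j) choose (m - j)) * (- z) ^ (m - j)) =
      (\<Sum>k\<le>n - j. real ((n - j) choose k) * (- z) ^ k)"
    by (rule sum.reindex_bij_witness[of _ "\<lambda>k. k + j" "\<lambda>m. m - j"]) (use assms in auto)
  also have "\<dots> = (- z + 1) ^ (n - j)"
    by (subst binomial_ring) simp
  finally show ?thesis by (simp add: algebra_simps)
qed

section \<open>Volumes of simplices and of crossing events\<close>

text \<open>Fixing \<open>x b = y\<close> leaves a standard simplex of side \<open>t - y\<close>;
  its volume is integrated over \<open>y\<close> by the fundamental theorem of calculus.\<close>

lemma emeasure_shifted_simplex:
  fixes c t :: real
  assumes A: "finite A" "b \<notin> A" and ct: "0 \<le> c" "c \<le> t"
  shows "emeasure (\<Pi>\<^sub>M i\<in>insert b A. lborel)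
      {x \<in> space (\<Pi>\<^sub>M i\<in>insert b A. lborel). (\<forall>i\<in>A. 0 \<le> x i) \<and> c < x b \<and> x b + sum x A \<le> t} =
    ennreal ((t - c) ^ Suc (card A) / fact (Suc (card A)))"
    (is "emeasure ?M ?S = _")
proof -
  interpret product_sigma_finite "\<lambda>_. lborel" by standard
  let ?N = "\<Pi>\<^sub>M i\<in>A. (lborel :: real measure)"
  define T where "T s = {x. (\<forall>i\<in>A. 0 \<le> x i) \<and> sum x A \<le> s} \<inter> space ?N" for s :: real
  have T_eq: "T s = {x \<in> space ?N. (\<forall>i\<in>A. 0 \<le> x i) \<and> sum x A \<le> s}" for s
    by (auto simp: T_def)
  have T_sets [measurable]: "T s \<in> sets ?N" for s
    unfolding T_eq using A by measurable
  have S_sets [measurable]: "?S \<in> sets ?M"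
    using A by measurable
  have upd: "indicator ?S (x(b := y)) = (indicator {c<..t} y * indicator (T (t - y)) x :: ennreal)"
    if x: "x \<in> space ?N" for x y
  proof -
    have "sum (x(b := y)) A = sum x A" using A by (intro sum.cong) auto
    moreover have "x(b := y) \<in> space ?M" using x by (auto simp: space_PiM PiE_def extensional_def)
    moreover have "(\<forall>i\<in>A. 0 \<le> (x(b := y)) i) \<longleftrightarrow> (\<forall>i\<in>A. 0 \<le> x i)" using A by auto
    \<comment> \<open>Nonnegativity of the sum forces \<open>y \<le> t\<close>, so \<open>y\<close>
      may be confined to \<open>{c<..t}\<close>.\<close>
    moreover have "0 \<le> sum x A" if "\<forall>i\<in>A. 0 \<le> x i" using that by (simp add: sum_nonneg)
    ultimately show ?thesis using x by (auto simp: indicator_def T_def)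
  qed
  have "emeasure ?M ?S = (\<integral>\<^sup>+ x. indicator ?S x \<partial>?M)"
    by (rule nn_integral_indicator [symmetric]) (rule S_sets)
  also have "\<dots> = (\<integral>\<^sup>+ y. \<integral>\<^sup>+ x. indicator ?S (x(b := y)) \<partial>?N \<partial>lborel)"
    using A by (intro product_nn_integral_insert_rev) auto
  also have "\<dots> = (\<integral>\<^sup>+ y. \<integral>\<^sup>+ x. indicator {c<..t} y * indicator (T (t - y)) x \<partial>?N \<partial>lborel)"
    by (intro nn_integral_cong upd)
  also have "\<dots> = (\<integral>\<^sup>+ y. indicator {c<..t} y * emeasure ?N (T (t - y)) \<partial>lborel)"
    by (subst nn_integral_cmult) auto
  also have "\<dots> = (\<integral>\<^sup>+ y. ennreal ((t - y) ^ card A / fact (card A)) * indicator {c<..t} y \<partial>lborel)"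
    using emeasure_std_simplex_aux[OF A(1)]
    by (intro nn_integral_cong) (auto simp: indicator_def T_def)
  \<comment> \<open>Adding the null set \<open>{c}\<close> closes the interval, as the fundamental
    theorem demands.\<close>
  also have "\<dots> = (\<integral>\<^sup>+ y. ennreal ((t - y) ^ card A / fact (card A)) * indicator {c..t} y \<partial>lborel)"
    using AE_lborel_singleton[of c]
    by (intro nn_integral_cong_AE) (auto simp: indicator_def elim!: eventually_mono)
  also have "\<dots> = ennreal (- ((t - t) ^ Suc (card A) / fact (Suc (card A))) -
      - ((t - c) ^ Suc (card A) / fact (Suc (card A))))"
  proof (rule nn_integral_FTC_Icc)
    show "((\<lambda>y. - ((t - y) ^ Suc (card A) / fact (Suc (card A)))) has_real_derivative
        (t - y) ^ card A / fact (card A)) (at y)" for y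
      by (rule derivative_eq_intros refl | simp)+
  qed (use ct in auto)
  finally show ?thesis by simp
qed

text \<open>
  Given a nonnegative vector on \<open>J\<close> of sum \<open>s \<le> z\<close>, the remaining coordinates fill a simplex of
  side \<open>t - z\<close>, because \<open>x b\<close> has to exceed \<open>z - s\<close>: the section measures do not depend on \<open>s\<close>.
\<close>

lemma emeasure_crossing:
  fixes z t :: real
  assumes fin: "finite J" "finite A" and disj: "b \<notin> A" "J \<inter> insert b A = {}" and zt: "0 \<le> z" "z \<le> t"
  shows "emeasure (\<Pi>\<^sub>M i\<in>J \<union> insert b A. lborel)
      {x \<in> space (\<Pi>\<^sub>M i\<in>J \<union> insert b A. lborel). (\<forall>i\<in>J. 0 \<le> x i) \<and> (\<forall>i\<in>A. 0 \<le> x i) \<and>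
        sum x J \<le> z \<and> z < sum x J + x b \<and> sum x J + (x b + sum x A) \<le> t} =
    ennreal (z ^ card J / fact (card J) * ((t - z) ^ Suc (card A) / fact (Suc (card A))))"
    (is "emeasure ?M ?S = _")
proof -
  interpret product_sigma_finite "\<lambda>_. lborel" by standard
  let ?K = "insert b A"
  let ?N = "\<Pi>\<^sub>M i\<in>J. (lborel :: real measure)" and ?L = "\<Pi>\<^sub>M i\<in>?K. (lborel :: real measure)"
  define T where "T = {x. (\<forall>i\<in>J. 0 \<le> x i) \<and> sum x J \<le> z} \<inter> space ?N"
  define U where "U s = {x \<in> space ?L. (\<forall>i\<in>A. 0 \<le> x i) \<and> z - s < x b \<and> x b + sum x A \<le> t - s}" for s
  have T_eq: "T = {x \<in> space ?N. (\<forall>i\<in>J. 0 \<le> x i) \<and> sum x J \<le> z}"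
    by (auto simp: T_def)
  have [measurable]: "T \<in> sets ?N" unfolding T_eq using fin by measurable
  have [measurable]: "U s \<in> sets ?L" for s unfolding U_def using fin by measurable
  have S_sets [measurable]: "?S \<in> sets ?M" using fin by measurable
  have mrg: "indicator ?S (merge J ?K (x, y)) = (indicator T x * indicator (U (sum x J)) y :: ennreal)"
    if x: "x \<in> space ?N" and y: "y \<in> space ?L" for x y
  proof -
    have "merge J ?K (x, y) \<in> space ?M"
      using x y by (auto simp: space_PiM)
    moreover have "sum (merge J ?K (x, y)) J = sum x J"
      by (intro sum.cong) (auto simp: merge_def)
    moreover have "sum (merge J ?K (x, y)) A = sum y A"
      using disj by (intro sum.cong) (auto simp: merge_def)
    moreover have "merge J ?K (x, y) b = y b" using disj by (simp add: merge_def)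
    moreover have "(\<forall>i\<in>J. 0 \<le> merge J ?K (x, y) i) \<longleftrightarrow> (\<forall>i\<in>J. 0 \<le> x i)"
      by (simp add: merge_def)
    moreover have "(\<forall>i\<in>A. 0 \<le> merge J ?K (x, y) i) \<longleftrightarrow> (\<forall>i\<in>A. 0 \<le> y i)"
      using disj by (auto simp: merge_def)
    ultimately show ?thesis using x y by (auto simp: indicator_def T_def U_def)
  qed
  have U: "emeasure ?L (U (sum x J)) = ennreal ((t - z) ^ Suc (card A) / fact (Suc (card A)))"
    if "x \<in> T" for x
    using emeasure_shifted_simplex[OF fin(2) disj(1), of "z - sum x J" "t - sum x J"] that zt
    by (simp add: T_def U_def)
  have "emeasure ?M ?S = (\<integral>\<^sup>+ x. indicator ?S x \<partial>?M)"
    by (rule nn_integral_indicator [symmetric]) (rule S_sets)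
  also have "\<dots> = (\<integral>\<^sup>+ x. \<integral>\<^sup>+ y. indicator ?S (merge J ?K (x, y)) \<partial>?L \<partial>?N)"
    using fin disj by (intro product_nn_integral_fold) auto
  also have "\<dots> = (\<integral>\<^sup>+ x. \<integral>\<^sup>+ y. indicator T x * indicator (U (sum x J)) y \<partial>?L \<partial>?N)"
    by (intro nn_integral_cong mrg)
  also have "\<dots> = (\<integral>\<^sup>+ x. indicator T x * emeasure ?L (U (sum x J)) \<partial>?N)"
    by (subst nn_integral_cmult) auto
  also have "\<dots> = (\<integral>\<^sup>+ x. ennreal ((t - z) ^ Suc (card A) / fact (Suc (card A))) * indicator T x \<partial>?N)"
    using U by (intro nn_integral_cong) (auto simp: indicator_def)
  also have "\<dots> = ennreal ((t - z) ^ Suc (card A) / fact (Suc (card A))) * emeasure ?N T"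
    by (rule nn_integral_cmult_indicator) measurable
  also have "emeasure ?N T = ennreal (z ^ card J / fact (card J))"
    using emeasure_std_simplex_aux[OF fin(1) zt(1)] by (simp add: T_def)
  finally show ?thesis using zt by (subst ennreal_mult) (auto simp: mult.commute)
qed

definition capped_simplex :: "nat \<Rightarrow> nat \<Rightarrow> real \<Rightarrow> (nat \<Rightarrow> real) set" where
  "capped_simplex n j z = {x \<in> simplex_params n. sum x {1..j} \<le> z}"

lemma sets_capped_simplex [measurable]:
  "j \<le> n \<Longrightarrow> capped_simplex n j z \<in> sets (\<Pi>\<^sub>M i\<in>{1..n}. lborel)"
  unfolding capped_simplex_def simplex_params_eq by measurable

text \<open>Downward induction from \<open>j = n\<close>, where the set is a simplex of side
  \<open>z\<close>. Each step adds the disjoint crossing event, whose volume is the increment in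
  \<open>F_step\<close> over \<open>fact n\<close>. Nonnegativity of \<open>F\<close> is carried
  along because sums of \<open>ennreal\<close> values need it.\<close>

lemma emeasure_capped_simplex:
  assumes "1 \<le> j" "j \<le> n" and z: "0 \<le> z" "z \<le> 1"
  shows "emeasure (\<Pi>\<^sub>M i\<in>{1..n}. lborel) (capped_simplex n j z) = ennreal (F n j z / fact n) \<and> 0 \<le> F n j z"
  using assms(2,1)
proof (induction j rule: inc_induct)
  case base
  have "capped_simplex n n z = {x. (\<forall>i\<in>{1..n}. 0 \<le> x i) \<and> sum x {1..n} \<le> z} \<inter>
      space (\<Pi>\<^sub>M i\<in>{1..n}. lborel)"
    using z by (auto simp: capped_simplex_def simplex_params_eq)
  then show ?case
    using base z emeasure_std_simplex_aux[of "{1..n}" z] by (simp add: F_self)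
next
  case (step j)
  let ?M = "\<Pi>\<^sub>M i\<in>{1..n}. (lborel :: real measure)"
  let ?A = "{j+2..n}"
  \<comment> \<open>The event that the cumulative sums pass \<open>z\<close> exactly between
    \<open>j\<close> and \<open>j + 1\<close>. The condition \<open>0 \<le> x (j + 1)\<close> is
    implied by the crossing.\<close>
  define W where "W = {x \<in> space ?M. (\<forall>i\<in>{1..j}. 0 \<le> x i) \<and> (\<forall>i\<in>?A. 0 \<le> x i) \<and>
    sum x {1..j} \<le> z \<and> z < sum x {1..j} + x (j + 1) \<and> sum x {1..j} + (x (j + 1) + sum x ?A) \<le> 1}"
  have I: "{1..n} = {1..j} \<union> insert (j + 1) ?A" using step by auto
  have sum: "sum x {1..n} = sum x {1..j} + (x (j + 1) + sum x ?A)" for x :: "nat \<Rightarrow> real"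
    unfolding I by (subst sum.union_disjoint) auto
  have cardA: "Suc (card ?A) = n - j" using step by simp
  have W: "emeasure ?M W = ennreal (z ^ j / fact j * ((1 - z) ^ (n - j) / fact (n - j)))"
    using emeasure_crossing[of "{1..j}" ?A "j + 1" z 1] z
    unfolding W_def I [symmetric] cardA by simp
  have all: "(\<forall>i\<in>{1..n}. P i) \<longleftrightarrow> (\<forall>i\<in>{1..j}. P i) \<and> P (j + 1) \<and> (\<forall>i\<in>?A. P i)" for P
    unfolding I by auto
  have un: "capped_simplex n j z = capped_simplex n (j + 1) z \<union> W"
    unfolding capped_simplex_def simplex_params_eq W_def all sum by (auto simp: not_le)
  have disj: "capped_simplex n (j + 1) z \<inter> W = {}"
    by (auto simp: capped_simplex_def W_def)
  have "W = capped_simplex n j z - capped_simplex n (j + 1) z"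
    using un disj by auto
  then have "W \<in> sets ?M"
    using step by (auto simp only: intro!: sets.Diff sets_capped_simplex)
  then have "emeasure ?M (capped_simplex n j z) = emeasure ?M (capped_simplex n (j + 1) z) + emeasure ?M W"
    unfolding un using step disj by (intro plus_emeasure [symmetric] sets_capped_simplex) auto
  also have "emeasure ?M (capped_simplex n (j + 1) z) = ennreal (F n (j + 1) z / fact n)"
    using step by simp
  also note W
  also have "z ^ j / fact j * ((1 - z) ^ (n - j) / fact (n - j)) =
      real (n choose j) * z ^ j * (1 - z) ^ (n - j) / fact n"
    using step by (simp add: binomial_fact field_simps)
  finally have "emeasure ?M (capped_simplex n j z) =
      ennreal (F n (j + 1) z / fact n + real (n choose j) * z ^ j * (1 - z) ^ (n - j) / fact n)"
    using step z by (simp add: ennreal_plus)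
  then show ?case
    using step z F_step[of j n z] by (simp add: add_divide_distrib)
qed

section \<open>The expected distance\<close>

lemma measurable_partial_sum:
  assumes "j \<le> m"
  shows "(\<lambda>x. partial_sum x j) \<in> borel_measurable (\<Pi>\<^sub>M k\<in>{1..m}. borel)"
  unfolding partial_sum_def using assms
  by (intro borel_measurable_sum measurable_component_singleton) auto

text \<open>For \<open>j \<le> n\<close> the cumulative sum involves only the free coordinates, so
  the event pulls back to \<open>capped_simplex\<close>, and the two factors \<open>fact n\<close>
  cancel in the quotient of volumes.\<close>

lemma uniform_simplex_partial_sum_le:
  assumes j: "1 \<le> j" "j \<le> n" and t: "0 \<le> t" "t \<le> 1"
  shows "measure (uniform_simplex n) {x \<in> space (\<Pi>\<^sub>M k\<in>{1..n+1}. borel). partial_sum x j \<le> t} = F n j t"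
    (is "measure _ ?B = _")
proof -
  let ?L = "\<Pi>\<^sub>M k\<in>{1..n}. (lborel :: real measure)"
  let ?U = "uniform_measure ?L (simplex_params n)"
  have meas: "simplex_param n \<in> measurable ?U (\<Pi>\<^sub>M k\<in>{1..n+1}. borel)"
    using simplex_param_measurable by (simp only: measurable_cong_sets[OF sets_uniform_measure refl])
  have [measurable]: "(\<lambda>x. partial_sum x j) \<in> borel_measurable (\<Pi>\<^sub>M k\<in>{1..n+1}. borel)"
    using j by (intro measurable_partial_sum) auto
  have B: "?B \<in> sets (\<Pi>\<^sub>M k\<in>{1..n+1}. borel)"
    by measurable
  have psum: "partial_sum (simplex_param n x) j = sum x {1..j}" for x
    unfolding partial_sum_def using j by (intro sum.cong) (auto simp: simplex_param_def)
  let ?P = "simplex_param n -` ?B \<inter> space ?U"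
  have int: "simplex_params n \<inter> ?P = capped_simplex n j t"
    using measurable_space[OF meas] sets.sets_into_space[OF simplex_params_sets[of n]]
    by (auto simp: capped_simplex_def psum)
  have "emeasure (uniform_simplex n) ?B = emeasure ?U ?P"
    unfolding uniform_simplex_def by (rule emeasure_distr[OF meas B])
  also have "\<dots> = emeasure ?L (simplex_params n \<inter> ?P) / emeasure ?L (simplex_params n)"
    using measurable_sets[OF meas B] simplex_params_sets[of n]
    by (intro emeasure_uniform_measure) (simp_all only: sets_uniform_measure)
  also have "\<dots> = ennreal (F n j t / fact n) / ennreal (1 / fact n)"
    using emeasure_capped_simplex[OF j t] unfolding int emeasure_simplex_params by simp
  also have "\<dots> = ennreal (F n j t)"
    using emeasure_capped_simplex[OF j t] by (subst divide_ennreal) auto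
  finally show ?thesis
    using emeasure_capped_simplex[OF j t] by (simp add: measure_def)
qed

lemma sets_prob_simplex [measurable]: "prob_simplex n \<in> sets (\<Pi>\<^sub>M j\<in>{1..n+1}. borel)"
proof -
  have "prob_simplex n = {x \<in> space (\<Pi>\<^sub>M j\<in>{1..n+1}. borel). (\<forall>j\<in>{1..n+1}. 0 \<le> x j) \<and> (\<Sum>j=1..n+1. x j) = 1}"
    by (auto simp: prob_simplex_def space_PiM)
  also have "\<dots> \<in> sets (\<Pi>\<^sub>M j\<in>{1..n+1}. borel)" by measurable
  finally show ?thesis .
qed

lemma AE_uniform_simplex: "AE x in uniform_simplex n. x \<in> prob_simplex n"
proof -
  let ?U = "uniform_measure (\<Pi>\<^sub>M j\<in>{1..n}. lborel) (simplex_params n)"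
  have meas: "simplex_param n \<in> measurable ?U (\<Pi>\<^sub>M k\<in>{1..n+1}. borel)"
    using simplex_param_measurable by (simp only: measurable_cong_sets[OF sets_uniform_measure refl])
  have "{x \<in> space (\<Pi>\<^sub>M k\<in>{1..n+1}. borel). x \<in> prob_simplex n} \<in> sets (\<Pi>\<^sub>M k\<in>{1..n+1}. borel)"
    by measurable
  moreover have "AE x in ?U. simplex_param n x \<in> prob_simplex n"
    by (intro AE_uniform_measureI simplex_params_sets AE_I2) (auto simp: simplex_params_def)
  ultimately show ?thesis
    unfolding uniform_simplex_def by (subst AE_distr_iff[OF meas])
qed

section \<open>Expectations of functions of a binomial count\<close>

lemma sum_card_Pow:
  fixes h :: "nat \<Rightarrow> real"
  assumes "finite I"
  shows "(\<Sum>A\<in>Pow I. h (card A)) = (\<Sum>k\<le>card I. real (card I choose k) * h k)"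
proof -
  have "(\<Sum>A\<in>Pow I. h (card A)) = (\<Sum>k\<le>card I. \<Sum>A | A \<in> Pow I \<and> card A = k. h (card A))"
    using assms by (intro sum.group [symmetric]) (auto intro: card_mono)
  also have "\<dots> = (\<Sum>k\<le>card I. \<Sum>A | A \<subseteq> I \<and> card A = k. h k)"
    by (intro sum.cong) auto
  finally show ?thesis using assms by (simp add: n_subsets)
qed

text \<open>The sample space is split by the set \<open>A\<close> of indices whose variable hits
  \<open>B\<close>. Independence gives each piece a product probability depending only on
  \<open>card A\<close>.\<close>

lemma (in prob_space) expectation_card_indep_vars:
  fixes f :: "nat \<Rightarrow> real" and I :: "'i set"
  assumes indep: "indep_vars (\<lambda>_. N) X I" and I: "finite I" "I \<noteq> {}" and B: "B \<in> sets N"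
    and p: "\<And>i. i \<in> I \<Longrightarrow> prob (X i -` B \<inter> space M) = p"
  shows "expectation (\<lambda>\<omega>. f (card {i\<in>I. X i \<omega> \<in> B})) =
    (\<Sum>k\<le>card I. real (card I choose k) * (f k * p ^ k * (1 - p) ^ (card I - k)))"
proof -
  define C where "C A i = (if i \<in> A then B else space N - B)" for A and i :: 'i
  \<comment> \<open>The event that exactly the indices in \<open>A\<close> hit \<open>B\<close>, for
    \<open>A\<close> a subset of \<open>I\<close>.\<close>
  define E where "E A = (\<Inter>i\<in>I. X i -` C A i \<inter> space M)" for A
  have rv: "X i \<in> measurable M N" if "i \<in> I" for i
    using indep that by (auto simp: indep_vars_def)
  have C: "C A i \<in> sets N" for A i using B by (auto simp: C_def)
  have E: "E A \<in> events" for A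
    unfolding E_def using I rv C by (intro sets.finite_INT) (auto intro: measurable_sets)
  have "f (card {i\<in>I. X i \<omega> \<in> B}) = (\<Sum>A\<in>Pow I. f (card A) * indicator (E A) \<omega>)"
    if \<omega>: "\<omega> \<in> space M" for \<omega>
  proof -
    have "indicator (E A) \<omega> = (if A = {i\<in>I. X i \<omega> \<in> B} then 1 else (0::real))" if "A \<in> Pow I" for A
      using that \<omega> I(2) measurable_space[OF rv \<omega>] by (auto simp: E_def C_def indicator_def split: if_splits)
    then have "(\<Sum>A\<in>Pow I. f (card A) * indicator (E A) \<omega>) =
        (\<Sum>A\<in>Pow I. if A = {i\<in>I. X i \<omega> \<in> B} then f (card A) else 0)"
      by (intro sum.cong) auto
    also have "\<dots> = f (card {i\<in>I. X i \<omega> \<in> B})"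
      using I by (subst sum.delta) auto
    finally show ?thesis ..
  qed
  then have "expectation (\<lambda>\<omega>. f (card {i\<in>I. X i \<omega> \<in> B})) =
      expectation (\<lambda>\<omega>. \<Sum>A\<in>Pow I. f (card A) * indicator (E A) \<omega>)"
    by (intro Bochner_Integration.integral_cong) auto
  also have "\<dots> = (\<Sum>A\<in>Pow I. f (card A) * prob (E A))"
    using E by (subst Bochner_Integration.integral_sum) (auto simp: emeasure_eq_measure)
  also have "\<dots> = (\<Sum>A\<in>Pow I. f (card A) * p ^ card A * (1 - p) ^ (card I - card A))"
  proof (intro sum.cong refl)
    fix A assume A: "A \<in> Pow I"
    have "prob (E A) = (\<Prod>i\<in>I. prob (X i -` C A i \<inter> space M))"
      unfolding E_def using I C by (intro indep_varsD_finite[OF indep]) auto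
    also have "\<dots> = (\<Prod>i\<in>I. if i \<in> A then p else 1 - p)"
    proof (intro prod.cong refl)
      fix i assume i: "i \<in> I"
      have "X i -` (space N - B) \<inter> space M = space M - (X i -` B \<inter> space M)"
        using measurable_space[OF rv[OF i]] by auto
      then show "prob (X i -` C A i \<inter> space M) = (if i \<in> A then p else 1 - p)"
        using p[OF i] prob_compl[OF measurable_sets[OF rv[OF i] B]] by (simp add: C_def)
    qed
    also have "\<dots> = p ^ card (I \<inter> A) * (1 - p) ^ card (I \<inter> - A)"
      using I by (simp add: prod.If_cases)
    also have "I \<inter> A = A" using A by auto
    also have "card (I \<inter> - A) = card I - card A"
      using A I by (subst card_Diff_subset [symmetric]) (auto intro: finite_subset simp: Diff_eq)
    finally show "f (card A) * prob (E A) = f (card A) * p ^ card A * (1 - p) ^ (card I - card A)"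
      by simp
  qed
  also have "\<dots> = (\<Sum>k\<le>card I. real (card I choose k) * (f k * p ^ k * (1 - p) ^ (card I - k)))"
    by (rule sum_card_Pow[OF I(1)])
  finally show ?thesis .
qed

section \<open>Restriction to levels in the unit interval and conclusion\<close>

lemma prob_simplex_partial_sum:
  assumes "x \<in> prob_simplex n" "j \<le> n + 1"
  shows "0 \<le> partial_sum x j" "partial_sum x j \<le> 1"
proof -
  have x: "\<And>k. k \<in> {1..n+1} \<Longrightarrow> 0 \<le> x k" and "partial_sum x (n + 1) = 1"
    using assms by (auto simp: prob_simplex_def partial_sum_def)
  then show "0 \<le> partial_sum x j" "partial_sum x j \<le> 1"
    using partial_sum_mono[of "n + 1" x 0 j] partial_sum_mono[of "n + 1" x j "n + 1"] assms(2) by auto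
qed

lemma feasible_prob_simplex:
  assumes "\<And>i. i \<in> {1..d} \<Longrightarrow> x i \<in> prob_simplex n" "1 \<le> d"
  shows "feasible n d x"
proof -
  have "partial_sum (x i) (n + 1) = 1" if "i \<in> {1..d}" for i
    using assms(1)[OF that] by (simp add: prob_simplex_def partial_sum_def)
  then show ?thesis using assms by (auto simp: feasible_def prob_simplex_def)
qed

text \<open>Below 0 no entry is counted and above 1 all are, and \<open>balance\<close> vanishes at
  both 0 and \<open>d\<close>. The levels then carry a probability measure, on which bounded
  functions are integrable.\<close>

lemma balance_integral_unit:
  assumes "1 \<le> d" and s: "\<And>i. i \<in> {1..d} \<Longrightarrow> 0 \<le> s i \<and> s i \<le> 1"
  shows "balance_integral d s =
    (LINT t|restrict_space lborel {0..1}. balance d (card {i\<in>{1..d}. s i \<le> t}))"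
proof -
  have "indicator {0..1} t *\<^sub>R balance d (card {i\<in>{1..d}. s i \<le> t}) = balance d (card {i\<in>{1..d}. s i \<le> t})"
    for t
  proof -
    have "card {i\<in>{1..d}. s i \<le> t} \<in> {0, d}" if "t \<notin> {0..1}"
    proof (cases "t < 0")
      case True
      then have "{i\<in>{1..d}. s i \<le> t} = {}" using s by force
      then show ?thesis by (simp only: card.empty insertI1)
    next
      case False
      then have "{i\<in>{1..d}. s i \<le> t} = {1..d}" using s that by force
      then show ?thesis by (simp only: card_atLeastAtMost) simp
    qed
    moreover have "balance d k = 0" if "k \<in> {0, d}" for k
      using that by (auto simp: balance_def)
    ultimately have "balance d (card {i\<in>{1..d}. s i \<le> t}) = 0" if "t \<notin> {0..1}"
      using that by blast
    then show ?thesis by (cases "t \<in> {0..1}") (simp_all only: indicator_simps scaleR_one scaleR_zero_left not_False_eq_True)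
  qed
  then show ?thesis
    unfolding balance_integral_def by (subst integral_restrict_space) (simp_all only:, simp)
qed

lemma continuous_on_F [continuous_intros]: "continuous_on A (F n j)"
  unfolding F_def by (intro continuous_intros)

theorem theorem4p2:
  fixes n d :: nat
    and M :: "'a measure"
    and X :: "nat \<Rightarrow> 'a \<Rightarrow> nat \<Rightarrow> real"
  assumes "n \<ge> 1" and "d \<ge> 2"
    and "prob_space M"
    and "prob_space.indep_vars M (\<lambda>_. \<Pi>\<^sub>M j\<in>{1..n+1}. borel) X {1..d}"
    and "\<And>i. i \<in> {1..d} \<Longrightarrow> distr M (\<Pi>\<^sub>M j\<in>{1..n+1}. borel) (X i) = uniform_simplex n"
  shows "integrable M (\<lambda>\<omega>. EMD n d (\<lambda>i. X i \<omega>)) \<and>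
         prob_space.expectation M (\<lambda>\<omega>. EMD n d (\<lambda>i. X i \<omega>)) =
           integral {0..1} (\<lambda>z. \<Sum>j=1..n. \<Sum>k=1..d-1.
             real (min k (d - k)) * real (d choose k) * F n j z ^ k * (1 - F n j z) ^ (d - k))"
proof -
  interpret prob_space M by fact
  let ?N = "\<Pi>\<^sub>M j\<in>{1..n+1}. (borel :: real measure)"
  let ?\<mu> = "restrict_space lborel {0..1::real}"
  have d: "1 \<le> d" using assms(2) by simp
  have rv: "X i \<in> measurable M ?N" if "i \<in> {1..d}" for i
    using assms(4) that by (auto simp: indep_vars_def)
  have S_meas: "(\<lambda>\<omega>. partial_sum (X i \<omega>) j) \<in> borel_measurable M"
    if "i \<in> {1..d}" "j \<le> n + 1" for i j
    using that by (intro measurable_compose[OF rv measurable_partial_sum]) auto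
  have X_meas: "(\<lambda>\<omega>. X i \<omega> j) \<in> borel_measurable M" if "i \<in> {1..d}" "j \<in> {1..n+1}" for i j
    using that by (intro measurable_compose[OF rv measurable_component_singleton]) auto

  define g where "g j \<omega> t = balance d (card {i\<in>{1..d}. partial_sum (X i \<omega>) j \<le> t})" for j \<omega> t
  define G where "G \<omega> = (\<Sum>j=1..n. balance_integral d (\<lambda>i. partial_sum (X i \<omega>) j))" for \<omega>
  have g_meas: "(\<lambda>(\<omega>, t). g j \<omega> t) \<in> borel_measurable (M \<Otimes>\<^sub>M lborel)" if "j \<in> {1..n}" for j
    unfolding g_def case_prod_beta
  proof (rule borel_measurable_card_comp)
    fix i assume i: "i \<in> {1..d}"
    have [measurable]: "(\<lambda>\<omega>. partial_sum (X i \<omega>) j) \<in> borel_measurable M"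
      using S_meas[OF i] that by auto
    show "{p \<in> space (M \<Otimes>\<^sub>M lborel). partial_sum (X i (fst p)) j \<le> snd p} \<in> sets (M \<Otimes>\<^sub>M lborel)"
      by measurable
  qed
  have G_meas: "G \<in> borel_measurable M"
    unfolding G_def balance_integral_def
    by (intro borel_measurable_sum
      lborel.borel_measurable_lebesgue_integral[OF g_meas, unfolded g_def])
  have feas_meas: "Measurable.pred M (\<lambda>\<omega>. feasible n d (\<lambda>i. X i \<omega>))"
    unfolding feasible_def
    using S_meas[of _ "n + 1"] X_meas d by measurable
  \<comment> \<open>Valid at every sample point, including the null set where the points leave the
    simplex; this makes the distance measurable outright.\<close>
  have EMD_eq: "EMD n d (\<lambda>i. X i \<omega>) = (if feasible n d (\<lambda>i. X i \<omega>) then G \<omega> else (LEAST c. False))" for \<omega>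
    using EMD_eq_balance_integral EMD_not_feasible d by (simp add: G_def)
  have EMD_meas: "(\<lambda>\<omega>. EMD n d (\<lambda>i. X i \<omega>)) \<in> borel_measurable M"
    unfolding EMD_eq using G_meas feas_meas by (intro measurable_If) auto

  have AE_X: "AE \<omega> in M. \<forall>i\<in>{1..d}. X i \<omega> \<in> prob_simplex n"
  proof (intro AE_finite_allI)
    fix i assume i: "i \<in> {1..d}"
    have "AE x in distr M ?N (X i). x \<in> prob_simplex n"
      unfolding assms(5)[OF i] by (rule AE_uniform_simplex)
    moreover have "{x \<in> space ?N. x \<in> prob_simplex n} \<in> sets ?N" by measurable
    ultimately show "AE \<omega> in M. X i \<omega> \<in> prob_simplex n"
      by (subst (asm) AE_distr_iff[OF rv[OF i]])
  qed simp
  \<comment> \<open>Almost surely the contribution of layer \<open>j\<close>, now with levels in the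
    unit interval only.\<close>
  define H where "H j \<omega> = (LINT t|?\<mu>. g j \<omega> t)" for j \<omega>
  have AE_EMD: "AE \<omega> in M. EMD n d (\<lambda>i. X i \<omega>) = (\<Sum>j=1..n. H j \<omega>)"
    using AE_X
  proof eventually_elim
    case (elim \<omega>)
    then have "feasible n d (\<lambda>i. X i \<omega>)" using d by (intro feasible_prob_simplex) auto
    moreover have "balance_integral d (\<lambda>i. partial_sum (X i \<omega>) j) = H j \<omega>" if "j \<in> {1..n}" for j
      unfolding H_def g_def using elim that
      by (intro balance_integral_unit d conjI prob_simplex_partial_sum[of _ n]) auto
    ultimately show ?case by (simp add: EMD_eq G_def)
  qed

  interpret U: prob_space ?\<mu>
    by (rule prob_space_restrict_space) auto
  interpret P: pair_prob_space M ?\<mu> ..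
  have g_int: "integrable (M \<Otimes>\<^sub>M ?\<mu>) (\<lambda>(\<omega>, t). g j \<omega> t)" if "j \<in> {1..n}" for j
  proof (rule P.integrable_const_bound)
    show "(\<lambda>(\<omega>, t). g j \<omega> t) \<in> borel_measurable (M \<Otimes>\<^sub>M ?\<mu>)"
    proof -
      have "id \<in> measurable ?\<mu> lborel" by (simp add: measurable_restrict_space1)
      then have "(\<lambda>p. (fst p, snd p)) \<in> measurable (M \<Otimes>\<^sub>M ?\<mu>) (M \<Otimes>\<^sub>M lborel)"
        by (intro measurable_Pair measurable_fst measurable_compose[OF measurable_snd, of id, unfolded id_def]) (auto simp: id_def)
      from measurable_compose[OF this g_meas[OF that]] show ?thesis
        by (simp add: case_prod_beta)
    qed
    show "AE p in M \<Otimes>\<^sub>M ?\<mu>. norm (case p of (\<omega>, t) \<Rightarrow> g j \<omega> t) \<le> real d"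
      by (intro AE_I2) (auto simp: g_def balance_nonneg balance_le)
  qed
  have H_int: "integrable M (H j)" if "j \<in> {1..n}" for j
    unfolding H_def using P.integrable_fst'[OF g_int[OF that]] by simp
  have sum_int: "integrable M (\<lambda>\<omega>. \<Sum>j=1..n. H j \<omega>)"
    by (intro Bochner_Integration.integrable_sum H_int)

  define Q where "Q j z = (\<Sum>k=1..d-1.
    real (min k (d - k)) * real (d choose k) * F n j z ^ k * (1 - F n j z) ^ (d - k))" for j z
  \<comment> \<open>For a fixed level the count is binomial with success probability
    \<open>F n j t\<close>.\<close>
  have Eg: "expectation (\<lambda>\<omega>. g j \<omega> t) = Q j t" if j: "j \<in> {1..n}" and t: "t \<in> {0..1}" for j t
  proof -
    define B where "B = {x \<in> space ?N. partial_sum x j \<le> t}"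
    have [measurable]: "(\<lambda>x. partial_sum x j) \<in> borel_measurable ?N"
      using j by (intro measurable_partial_sum) auto
    have B: "B \<in> sets ?N"
      unfolding B_def by measurable
    have p: "prob (X i -` B \<inter> space M) = F n j t" if i: "i \<in> {1..d}" for i
    proof -
      have "prob (X i -` B \<inter> space M) = measure (distr M ?N (X i)) B"
        using rv[OF i] B by (simp add: measure_distr)
      also have "\<dots> = F n j t"
        unfolding assms(5)[OF i] B_def using j t by (intro uniform_simplex_partial_sum_le) auto
      finally show ?thesis .
    qed
    have "expectation (\<lambda>\<omega>. g j \<omega> t) = expectation (\<lambda>\<omega>. balance d (card {i\<in>{1..d}. X i \<omega> \<in> B}))"
    proof (intro Bochner_Integration.integral_cong refl)
      fix \<omega> assume "\<omega> \<in> space M"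
      then have "{i\<in>{1..d}. partial_sum (X i \<omega>) j \<le> t} = {i\<in>{1..d}. X i \<omega> \<in> B}"
        using measurable_space[OF rv] by (auto simp: B_def)
      then show "g j \<omega> t = balance d (card {i\<in>{1..d}. X i \<omega> \<in> B})" by (simp only: g_def)
    qed
    also have "\<dots> = (\<Sum>k\<le>d. real (d choose k) * (balance d k * F n j t ^ k * (1 - F n j t) ^ (d - k)))"
      using expectation_card_indep_vars[OF assms(4) _ _ B p, of "balance d"] d by simp
    \<comment> \<open>The extreme terms \<open>k = 0\<close> and \<open>k = d\<close> drop out
      because \<open>balance\<close> is 0 there.\<close>
    also have "\<dots> = (\<Sum>k=1..d-1. real (d choose k) * (balance d k * F n j t ^ k * (1 - F n j t) ^ (d - k)))"
    proof (rule sum.mono_neutral_right)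
      show "\<forall>k\<in>{..d} - {1..d-1}. real (d choose k) * (balance d k * F n j t ^ k * (1 - F n j t) ^ (d - k)) = 0"
      proof
        fix k assume "k \<in> {..d} - {1..d-1}"
        then have "k = 0 \<or> k = d" by auto
        then show "real (d choose k) * (balance d k * F n j t ^ k * (1 - F n j t) ^ (d - k)) = 0"
          by (auto simp: balance_def)
      qed
    qed auto
    also have "\<dots> = Q j t"
      unfolding Q_def by (intro sum.cong) (auto simp: balance_def)
    finally show ?thesis .
  qed
  have Q_cont: "continuous_on {0..1} (Q j)" for j
    unfolding Q_def by (intro continuous_intros)
  have EH: "expectation (H j) = integral {0..1} (Q j)" if j: "j \<in> {1..n}" for j
  proof -
    have "expectation (H j) = (LINT t|?\<mu>. expectation (\<lambda>\<omega>. g j \<omega> t))"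
      unfolding H_def by (rule P.Fubini_integral [symmetric, OF g_int[OF j]])
    also have "\<dots> = (LINT t|?\<mu>. Q j t)"
      using Eg[OF j] by (intro Bochner_Integration.integral_cong) (auto simp: space_restrict_space)
    \<comment> \<open>Passage from the Lebesgue integral to the gauge integral of the statement,
      justified by continuity of \<open>Q j\<close>.\<close>
    also have "\<dots> = (LINT t:{0..1}|lborel. Q j t)"
      unfolding set_lebesgue_integral_def by (rule integral_restrict_space) auto
    also have "\<dots> = integral {0..1} (Q j)"
      by (intro set_borel_integral_eq_integral borel_integrable_atLeastAtMost' Q_cont)
    finally show ?thesis .
  qed
  have "expectation (\<lambda>\<omega>. EMD n d (\<lambda>i. X i \<omega>)) = expectation (\<lambda>\<omega>. \<Sum>j=1..n. H j \<omega>)"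
    using EMD_meas sum_int AE_EMD by (intro integral_cong_AE) auto
  also have "\<dots> = (\<Sum>j=1..n. integral {0..1} (Q j))"
    using H_int EH by (subst Bochner_Integration.integral_sum) auto
  also have "\<dots> = integral {0..1} (\<lambda>z. \<Sum>j=1..n. Q j z)"
    using Q_cont by (intro integral_sum [symmetric] integrable_continuous_interval) auto
  finally have "expectation (\<lambda>\<omega>. EMD n d (\<lambda>i. X i \<omega>)) = integral {0..1} (\<lambda>z. \<Sum>j=1..n. Q j z)" .
  moreover have "integrable M (\<lambda>\<omega>. EMD n d (\<lambda>i. X i \<omega>))"
  proof (rule integrable_cong_AE_imp[OF sum_int EMD_meas])
    show "AE \<omega> in M. (\<Sum>j=1..n. H j \<omega>) = EMD n d (\<lambda>i. X i \<omega>)"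
      using AE_EMD by eventually_elim (rule sym)
  qed
  ultimately show ?thesis unfolding Q_def by (intro conjI)
qed

thm_deps theorem4p2

end
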